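(* Let $X$ be a geodesic metric space homeomorphic to $\overline{D}$, with boundary circle $\partial X$. Let $v\colon\overline{D}\to X$ be a continuous surjective map such that: (i) the restriction of $v$ to $S^1$ is a weakly monotone parametrization of $\partial X$; and (ii) whenever $T\subset X$ is a single point or is biLipschitz homeomorphic to a closed interval, every connected component of $v^{-1}(T)$ is cell-like. Then $v$ is a cell-like map.
   Context: $\overline{D}$ is the closed unit disc in $\mathbb{R}^2$ with boundary $S^1$. A continuous $c\colon S^1\to\Gamma$ onto a Jordan curve $\Gamma$ is a weakly monotone parametrization if it is a uniform limit of homeomorphisms $S^1\to\Gamma$. A compact metric space is cell-like if it admits an embedding into the Hilbert cube in which it is null-homotopic in every neighborhood of itself. A continuous surjection $f\colon Y\to Z$ is cell-like if $f^{-1}(q)$ is cell-like for every $q\in Z$. *)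

theory Defs
  imports "HOL-Analysis.Analysis"
begin

definition hilbert_cube :: "(nat \<Rightarrow> real) topology" where
  "hilbert_cube = product_topology (\<lambda>_. top_of_set {0..1::real}) UNIV"

definition cell_like :: "'a::metric_space set \<Rightarrow> bool" where
  "cell_like K \<longleftrightarrow> compact K \<and>
     (\<exists>e. embedding_map (top_of_set K) hilbert_cube e \<and>
        (\<forall>U. openin hilbert_cube U \<and> e ` K \<subseteq> U \<longrightarrow>
           (\<exists>c. homotopic_with (\<lambda>_. True) (subtopology hilbert_cube (e ` K))
                  (subtopology hilbert_cube U) id (\<lambda>_. c))))"

definition geodesic_space :: "'a::metric_space set \<Rightarrow> bool" where
  "geodesic_space X \<longleftrightarrow>
     (\<forall>x\<in>X. \<forall>y\<in>X. \<exists>\<gamma>::real \<Rightarrow> 'a.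
        \<gamma> 0 = x \<and> \<gamma> (dist x y) = y \<and> \<gamma> ` {0..dist x y} \<subseteq> X \<and>
        (\<forall>s\<in>{0..dist x y}. \<forall>t\<in>{0..dist x y}. dist (\<gamma> s) (\<gamma> t) = \<bar>s - t\<bar>))"

definition weakly_monotone_param :: "(complex \<Rightarrow> 'a::metric_space) \<Rightarrow> 'a set \<Rightarrow> bool" where
  "weakly_monotone_param c \<Gamma> \<longleftrightarrow>
     continuous_on (sphere 0 1) c \<and> c ` sphere 0 1 = \<Gamma> \<and>
     (\<exists>f :: nat \<Rightarrow> complex \<Rightarrow> 'a.
        (\<forall>n. \<exists>g. homeomorphism (sphere 0 1) \<Gamma> (f n) g) \<and>
        uniform_limit (sphere 0 1) f c sequentially)"

definition bilipschitz_arc :: "'a::metric_space set \<Rightarrow> bool" where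
  "bilipschitz_arc T \<longleftrightarrow>
     (\<exists>a b::real. \<exists>f::real \<Rightarrow> 'a. \<exists>L>0. a < b \<and> f ` {a..b} = T \<and>
        (\<forall>s\<in>{a..b}. \<forall>t\<in>{a..b}.
           dist s t \<le> L * dist (f s) (f t) \<and> dist (f s) (f t) \<le> L * dist s t))"

end

(*
  It suffices that the fibres of v are connected, since a connected fibre is its own component.
  Transport everything to the closed disc D along h and write w for the resulting self-map of D.

  A cell-like compact subset of the plane does not separate it, so if T is a bilipschitz arc then no
  compact relatively clopen part of the preimage of T separates the plane.  Let K be the part of a
  chord from x to an end point p on the circle, and let U be open in the interior of D with w mapping
  its frontier off K.  Then w maps all of U off K: in a thin neighbourhood of K a bilipschitz arc T
  runs from the circle around K back to the circle on the other side of p, and a point of U over K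
  would be cut off from the frontier of U by the preimage of T in U.  (In a geodesic space any two
  points of a connected open set are joined in it by a bilipschitz arc.)

  As the fibre of w in the circle over p is connected, it follows that the preimage of K is connected.
  For q in the interior let K be the union of two such segments S, S' from q to the circle.  A bounded
  complementary component R of the preimage of K would contain a point z with w z off K, and the ray
  from q through w z contradicts the previous statement for U = R.  So the preimage of K does not
  separate the plane, and by Janiszewski's theorem the preimages of S and S' have a connected
  intersection, which is the fibre over q.
*)
theory Submission
  imports Defs "HOL-Complex_Analysis.Winding_Numbers"
begin

section \<open>Bilipschitz arcs in geodesic spaces\<close>

definition bilipschitz_joins :: "'a::metric_space set \<Rightarrow> 'a \<Rightarrow> 'a \<Rightarrow> bool" where
  "bilipschitz_joins S x y \<longleftrightarrow>
     (\<exists>a b f L. a \<le> b \<and> L > 0 \<and> f a = x \<and> f b = y \<and> f ` {a..b} \<subseteq> S \<and>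
        (\<forall>s\<in>{a..b::real}. \<forall>t\<in>{a..b}.
           dist s t \<le> L * dist (f s) (f t) \<and> dist (f s) (f t) \<le> L * dist s t))"

text \<open>The given arc is cut at a point \<^term>\<open>z\<close> nearest to \<^term>\<open>y\<close> and continued by a geodesic
  from \<^term>\<open>z\<close> to \<^term>\<open>y\<close>. For \<^term>\<open>w\<close> on the geodesic and \<^term>\<open>u\<close> on the arc, minimality of
  \<^term>\<open>dist y z\<close> gives \<^term>\<open>dist u z + dist z w \<le> 3 * dist u w\<close>, so the corner is not a cusp.\<close>

lemma bilipschitz_joins_extend:
  assumes geo: "geodesic_space X" and "S \<subseteq> X"
    and J: "bilipschitz_joins S x y'" and y: "y \<in> S"
    and near: "cball y (dist y' y) \<inter> X \<subseteq> S"
  shows "bilipschitz_joins S x y"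
proof -
  obtain a b f L where ab: "a \<le> b" and L: "L > 0" and fa: "f a = x" and fb: "f b = y'"
    and fS: "f ` {a..b} \<subseteq> S"
    and bl: "\<And>s t. s \<in> {a..b} \<Longrightarrow> t \<in> {a..b} \<Longrightarrow>
           dist s t \<le> L * dist (f s) (f t) \<and> dist (f s) (f t) \<le> L * dist s (t::real)"
    using J unfolding bilipschitz_joins_def by (elim exE conjE) (rule that, assumption+, simp)
  have "continuous_on {a..b} f"
    by (rule lipschitz_on_continuous_on[of L]) (use bl L in \<open>auto intro!: lipschitz_onI\<close>)
  then have "continuous_on {a..b} (\<lambda>t. dist y (f t))"
    by (intro continuous_intros)
  then obtain c where c: "c \<in> {a..b}" and cmin: "\<And>t. t \<in> {a..b} \<Longrightarrow> dist y (f c) \<le> dist y (f t)"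
    using continuous_attains_inf[of "{a..b}" "\<lambda>t. dist y (f t)"] ab by auto
  define l where "l = dist (f c) y"
  have fcX: "f c \<in> X" and "y \<in> X"
    using c fS \<open>S \<subseteq> X\<close> y by blast+
  then obtain g where g0: "g 0 = f c" and gl: "g l = y" and gX: "g ` {0..l} \<subseteq> X"
    and giso: "\<And>s t. s \<in> {0..l} \<Longrightarrow> t \<in> {0..l} \<Longrightarrow> dist (g s) (g t) = \<bar>s - t\<bar>"
    using geo unfolding geodesic_space_def l_def by metis
  have l0: "l \<ge> 0"
    by (simp add: l_def)
  \<comment> \<open>As \<open>f c\<close> is a point of the arc nearest to \<open>y\<close>, the
    geodesic has length \<open>l \<le> dist y' y\<close> and stays in the ball from
    \<open>near\<close>.\<close>
  have gS: "g ` {0..l} \<subseteq> S"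
  proof clarify
    fix s assume s: "s \<in> {0..l}"
    have "dist y (g s) = \<bar>l - s\<bar>"
      using giso[of l s] gl l0 s by auto
    also have "\<dots> \<le> dist y' y"
      using cmin[of b] fb s ab by (auto simp: l_def dist_commute)
    finally show "g s \<in> S"
      using near gX s by (auto simp: subset_iff image_subset_iff)
  qed
  have key: "dist (f s) (f c) + u \<le> 3 * dist (f s) (g u)" if s: "s \<in> {a..c}" and u: "u \<in> {0..l}" for s u
  proof -
    have gu: "dist (f c) (g u) = u"
      using giso[of 0 u] g0 u l0 by auto
    have yu: "dist y (g u) = l - u"
      using giso[of l u] gl u l0 by auto
    have "l \<le> dist y (f s)"
      using cmin[of s] s c by (auto simp: l_def dist_commute)
    also have "\<dots> \<le> dist y (g u) + dist (f s) (g u)"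
      by (rule dist_triangle2)
    finally have 1: "u \<le> dist (f s) (g u)"
      using yu by simp
    moreover have "dist (f s) (f c) \<le> dist (f s) (g u) + u"
      using gu dist_triangle2[of "f s" "f c" "g u"] by simp
    ultimately show ?thesis by simp
  qed
  define F where "F t = (if t \<le> c then f t else g (t - c))" for t
  \<comment> \<open>The factor 3 comes from \<open>key\<close>; \<open>L + 1\<close> dominates both
    the constant of \<open>f\<close> and the constant 1 of the geodesic.\<close>
  define M where "M = 3 * (L + 1)"
  have LM: "L \<le> M" "1 \<le> M" "L + 1 \<le> M" using L by (auto simp: M_def)
  have bound: "dist s t \<le> M * dist (F s) (F t) \<and> dist (F s) (F t) \<le> M * dist s t"
    if s: "s \<in> {a..c+l}" and t: "t \<in> {a..c+l}" and st: "s \<le> t" for s t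
  proof -
    consider "t \<le> c" | "s \<le> c" "c < t" | "c < s" by linarith
    then show ?thesis
    proof cases
      case 1
      have "dist s t \<le> L * dist (f s) (f t)" "dist (f s) (f t) \<le> L * dist s t"
        using bl[of s t] c s t st 1 by auto
      moreover have "L * dist (f s) (f t) \<le> M * dist (f s) (f t)" "L * dist s t \<le> M * dist s t"
        using LM by (auto intro: mult_right_mono)
      ultimately show ?thesis
        using 1 st by (simp add: F_def)
    next
      case 2
      define u where "u = t - c"
      have u: "u \<in> {0..l}" using 2 t by (auto simp: u_def)
      have b1: "c - s \<le> L * dist (f s) (f c)" "dist (f s) (f c) \<le> L * (c - s)"
        using bl[of s c] c s 2 by (auto simp: dist_real_def)
      have gu: "dist (f c) (g u) = u"
        using giso[of 0 u] g0 u l0 by auto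
      have "dist (f s) (g u) \<le> dist (f s) (f c) + u"
        using gu dist_triangle[of "f s" "g u" "f c"] by simp
      also have "\<dots> \<le> L * (c - s) + 1 * (t - c)"
        using b1 by (simp add: u_def)
      also have "\<dots> \<le> M * (c - s) + M * (t - c)"
        using 2 LM by (intro add_mono mult_right_mono) auto
      finally have up: "dist (f s) (g u) \<le> M * (t - s)"
        by (simp add: algebra_simps)
      have "t - s \<le> L * dist (f s) (f c) + 1 * u"
        using b1 by (simp add: u_def)
      also have "\<dots> \<le> (L + 1) * dist (f s) (f c) + (L + 1) * u"
        using u L by (intro add_mono mult_right_mono) auto
      also have "\<dots> \<le> (L + 1) * (3 * dist (f s) (g u))"
        unfolding distrib_left[symmetric] using key[of s u] s 2 u L by (intro mult_left_mono) auto
      finally show ?thesis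
        using up 2 st by (simp add: F_def M_def u_def dist_real_def algebra_simps)
    next
      case 3
      then have "dist (F s) (F t) = t - s"
        using giso[of "s - c" "t - c"] s t st by (auto simp: F_def)
      moreover have "t - s \<le> M * (t - s)"
        using LM st mult_right_mono[of 1 M "t - s"] by simp
      ultimately show ?thesis using st by (simp add: dist_real_def)
    qed
  qed
  have FS: "F ` {a..c+l} \<subseteq> S"
    using fS gS c by (auto simp: F_def image_subset_iff)
  \<comment> \<open>If \<open>l = 0\<close>, the last parameter is \<open>c\<close>, where
    \<open>F\<close> takes its value from \<open>f\<close>; then
    \<open>f c = g 0 = y\<close>.\<close>
  have Fe: "F (c + l) = y"
    using gl g0 l0 by (cases "l = 0") (auto simp: F_def)
  have "\<forall>s\<in>{a..c+l}. \<forall>t\<in>{a..c+l}. dist s t \<le> M * dist (F s) (F t) \<and> dist (F s) (F t) \<le> M * dist s t"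
    using bound by (metis dist_commute linorder_le_cases)
  moreover have "F a = x" "a \<le> c + l" "M > 0"
    using c fa l0 LM by (auto simp: F_def)
  ultimately show ?thesis
    unfolding bilipschitz_joins_def using Fe FS by blast
qed

text \<open>By the extension lemma, used from \<open>z\<close> to \<open>w\<close> and back, being
  joined to \<open>x\<close> is locally constant on \<open>S\<close>, hence constant on a connected
  \<open>S\<close>.\<close>

lemma bilipschitz_joins_connected:
  assumes geo: "geodesic_space X" and S: "openin (top_of_set X) S" and "connected S"
    and x: "x \<in> S" and y: "y \<in> S"
  shows "bilipschitz_joins S x y"
proof -
  have SX: "S \<subseteq> X" using S openin_imp_subset by blast
  have refl: "bilipschitz_joins S x x"
    unfolding bilipschitz_joins_def
    by (rule exI[of _ 0], rule exI[of _ 0], rule exI[of _ "\<lambda>_. x"], rule exI[of _ 1]) (use x in auto)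
  have rad: "\<exists>r>0. \<forall>w\<in>S \<inter> ball z r. bilipschitz_joins S x w \<longleftrightarrow> bilipschitz_joins S x z" if z: "z \<in> S" for z
  proof -
    obtain r where r: "r > 0" "ball z r \<inter> X \<subseteq> S"
      using S z unfolding openin_contains_ball by blast
    \<comment> \<open>Half the radius, because the ball around \<open>w\<close> of radius
      \<open>dist z w\<close> must still lie in \<open>ball z r\<close>.\<close>
    have "bilipschitz_joins S x w \<longleftrightarrow> bilipschitz_joins S x z" if w: "w \<in> S \<inter> ball z (r/2)" for w
    proof
      have wz: "dist w z < r/2" using w by (auto simp: dist_commute)
      show "bilipschitz_joins S x z" if "bilipschitz_joins S x w"
        by (rule bilipschitz_joins_extend[OF geo SX that z])
           (use r wz in \<open>auto simp: subset_iff\<close>)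
      show "bilipschitz_joins S x w" if "bilipschitz_joins S x z"
      proof (rule bilipschitz_joins_extend[OF geo SX that])
        show "w \<in> S" using w by auto
        have "dist z u < r" if "dist w u \<le> dist z w" for u
          using dist_triangle[of z u w] that wz by (simp add: dist_commute)
        then have "cball w (dist z w) \<subseteq> ball z r"
          by auto
        then show "cball w (dist z w) \<inter> X \<subseteq> S" using r by blast
      qed
    qed
    then show ?thesis using r by (intro exI[of _ "r/2"]) auto
  qed
  have "bilipschitz_joins S x x \<longleftrightarrow> bilipschitz_joins S x y"
  proof (rule connected_equivalence_relation[where R = "\<lambda>u w. bilipschitz_joins S x u \<longleftrightarrow> bilipschitz_joins S x w",
        OF \<open>connected S\<close> x y])
    fix z assume z: "z \<in> S"
    obtain r where r: "r > 0" "\<forall>w\<in>S \<inter> ball z r. bilipschitz_joins S x w \<longleftrightarrow> bilipschitz_joins S x z"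
      using rad[OF z] by blast
    show "\<exists>T. openin (top_of_set S) T \<and> z \<in> T \<and>
         (\<forall>w\<in>T. bilipschitz_joins S x z \<longleftrightarrow> bilipschitz_joins S x w)"
    proof (intro exI conjI ballI)
      show "openin (top_of_set S) (S \<inter> ball z r)" "z \<in> S \<inter> ball z r"
        using z r by auto
    qed (use r in blast)
  qed simp_all
  then show ?thesis using refl by blast
qed

section \<open>Cell-like sets and monotone boundary parametrizations\<close>

lemma
  shows compact_space_hilbert_cube: "compact_space hilbert_cube"
    and Hausdorff_space_hilbert_cube: "Hausdorff_space hilbert_cube"
  unfolding hilbert_cube_def
  by (auto simp: compact_space_product_topology Hausdorff_space_product_topology
      compact_space_subtopology Hausdorff_space_subtopology)

text \<open>A map into the punctured plane extends by Tietze to a neighbourhood of the embedded copy, where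
  that copy can be contracted.\<close>

lemma cell_like_imp_Borsukian:
  fixes K :: "'a::real_normed_vector set"
  assumes "cell_like K"
  shows "Borsukian K"
  unfolding Borsukian_def
proof (intro allI impI, elim conjE)
  fix f :: "'a \<Rightarrow> complex"
  assume contf: "continuous_on K f" and f0: "f \<in> K \<rightarrow> - {0}"
  obtain e where e: "embedding_map (top_of_set K) hilbert_cube e"
    and contr: "\<And>U. openin hilbert_cube U \<Longrightarrow> e ` K \<subseteq> U \<Longrightarrow>
           \<exists>c. homotopic_with (\<lambda>_. True) (subtopology hilbert_cube (e ` K))
                  (subtopology hilbert_cube U) id (\<lambda>_. c)"
    and "compact K"
    using assms unfolding cell_like_def by (elim exE conjE) (rule that, assumption, simp, assumption)
  let ?Q = hilbert_cube
  obtain g where g: "homeomorphic_maps (top_of_set K) (subtopology ?Q (e ` K)) e g"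
    using e unfolding embedding_map_def homeomorphic_map_maps by auto
  have ce: "continuous_map (top_of_set K) (subtopology ?Q (e ` K)) e"
    and cg: "continuous_map (subtopology ?Q (e ` K)) (top_of_set K) g"
    and ge: "\<And>x. x \<in> K \<Longrightarrow> g (e x) = x"
    using g by (auto simp: homeomorphic_maps_def)
  have "continuous_map (top_of_set K) ?Q e"
    using ce continuous_map_into_fulltopology by blast
  then have eK: "e ` K \<subseteq> topspace ?Q" and "compactin ?Q (e ` K)"
    using image_compactin[of "top_of_set K" K ?Q e] \<open>compact K\<close>
    by (auto simp: compactin_subtopology continuous_map_def)
  then have clo: "closedin ?Q (e ` K)"
    using compactin_imp_closedin Hausdorff_space_hilbert_cube by blast
  have normal: "normal_space ?Q"
    by (simp add: compact_Hausdorff_or_regular_imp_normal_space compact_space_hilbert_cube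
        Hausdorff_space_hilbert_cube)
  have cfg: "continuous_map (subtopology ?Q (e ` K)) euclidean (f \<circ> g)"
    using continuous_map_compose[OF cg, of euclidean f] contf by simp
  \<comment> \<open>Tietze is applied to the real and imaginary parts separately; the combined
    extension may vanish away from the embedded copy.\<close>
  have "continuous_map (subtopology ?Q (e ` K)) euclideanreal (Re \<circ> (f \<circ> g))"
       "continuous_map (subtopology ?Q (e ` K)) euclideanreal (Im \<circ> (f \<circ> g))"
    by (intro continuous_map_compose[OF cfg]; simp add: continuous_on_Re continuous_on_Im continuous_on_id)+
  then obtain F1 F2 where cF: "continuous_map ?Q euclideanreal F1" "continuous_map ?Q euclideanreal F2"
    and F1: "\<And>y. y \<in> e ` K \<Longrightarrow> F1 y = (Re \<circ> (f \<circ> g)) y"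
    and F2: "\<And>y. y \<in> e ` K \<Longrightarrow> F2 y = (Im \<circ> (f \<circ> g)) y"
    using Tietze_extension_realinterval[OF normal clo is_interval_univ UNIV_not_empty _ subset_UNIV, of "Re \<circ> (f \<circ> g)"]
      Tietze_extension_realinterval[OF normal clo is_interval_univ UNIV_not_empty _ subset_UNIV, of "Im \<circ> (f \<circ> g)"]
    by (smt (verit))
  define F where "F y = complex_of_real (F1 y) + \<i> * complex_of_real (F2 y)" for y
  have of_real: "continuous_map euclideanreal euclidean complex_of_real"
    by (simp add: continuous_on_of_real continuous_on_id)
  have im: "continuous_map euclidean euclidean ((*) \<i>)"
    by (simp add: continuous_on_mult continuous_on_id)
  have contF: "continuous_map ?Q euclidean F"
    unfolding F_def
    using continuous_map_compose[OF cF(1) of_real]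
      continuous_map_compose[OF continuous_map_compose[OF cF(2) of_real] im]
    by (auto simp: o_def intro: continuous_map_add)
  have Fe: "F (e x) = f x" if "x \<in> K" for x
    using that by (simp add: F_def F1 F2 ge complex_eq_iff)
  \<comment> \<open>On \<open>U\<close> the extension avoids 0. The contraction of the copy inside
    \<open>U\<close>, composed with \<open>e\<close> and \<open>F\<close>, is a null homotopy of
    \<open>f\<close> in the punctured plane.\<close>
  define U where "U = {y \<in> topspace ?Q. F y \<in> - {0}}"
  have "openin ?Q U"
    unfolding U_def by (rule openin_continuous_map_preimage[OF contF]) (simp add: open_Compl)
  moreover have "e ` K \<subseteq> U"
    using eK f0 by (auto simp: U_def Fe)
  ultimately obtain c where c: "homotopic_with (\<lambda>_. True) (subtopology ?Q (e ` K)) (subtopology ?Q U) id (\<lambda>_. c)"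
    using contr by blast
  have FU: "continuous_map (subtopology ?Q U) (top_of_set (- {0})) F"
    using contF by (auto simp: continuous_map_in_subtopology U_def continuous_map_from_subtopology)
  have "homotopic_with_canon (\<lambda>_. True) K (- {0}) (F \<circ> id \<circ> e) (F \<circ> (\<lambda>_. c) \<circ> e)"
    by (rule homotopic_with_compose_continuous_map_right[OF
          homotopic_with_compose_continuous_map_left[where q = "\<lambda>_. True", OF c FU] ce]) auto
  then have "homotopic_with_canon (\<lambda>_. True) K (- {0}) f (\<lambda>x. F c)"
    by (rule homotopic_with_eq) (auto simp: Fe)
  then show "\<exists>a. homotopic_with_canon (\<lambda>h. True) K (- {0}) f (\<lambda>x. a)" ..
qed

text \<open>Borsuk's criterion: a compact planar set whose maps into the punctured plane are all
  inessential does not separate the plane.\<close>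

lemma cell_like_imp_connected_complement:
  fixes K :: "complex set"
  assumes "cell_like K"
  shows "connected (- K)"
  using Borsukian_separation_compact assms cell_like_imp_Borsukian cell_like_def by blast

lemma compact_disconnected_open_split:
  fixes K :: "'a::metric_space set"
  assumes "compact K" "\<not> connected K"
  obtains A B U V where "A \<union> B = K" "A \<noteq> {}" "B \<noteq> {}" "closed A" "closed B"
    "open U" "open V" "U \<inter> V = {}" "A \<subseteq> U" "B \<subseteq> V"
proof -
  obtain A B where AB: "closed A" "closed B" "A \<noteq> {}" "B \<noteq> {}" "A \<union> B = K" "A \<inter> B = {}"
    using assms connected_closed_set compact_imp_closed by metis
  obtain U V where "open U" "open V" "U \<inter> V = {}" "A \<subseteq> U" "B \<subseteq> V"
    using AB t4_space[of A B] by metis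
  then show ?thesis using that AB by blast
qed

text \<open>A homeomorphism close to \<open>c\<close> pulls a small connected neighbourhood of
  \<open>p\<close> back to a connected set that contains the whole fibre. If the fibre were split by
  \<open>U\<close> and \<open>V\<close>, this set would lie in \<open>U \<union> V\<close> and meet
  both.\<close>

lemma weakly_monotone_param_connected_fibre:
  assumes wm: "weakly_monotone_param c \<Gamma>" and lc: "locally connected \<Gamma>" and "p \<in> \<Gamma>"
  shows "connected {z \<in> sphere 0 1. c z = p}"
proof (rule ccontr)
  let ?S = "sphere 0 1 :: complex set"
  let ?F = "{z \<in> ?S. c z = p}"
  assume nc: "\<not> connected ?F"
  obtain f where contc: "continuous_on ?S c" and f: "\<And>n. \<exists>g. homeomorphism ?S \<Gamma> (f n) g"
    and lim: "uniform_limit ?S f c sequentially"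
    using wm unfolding weakly_monotone_param_def by blast
  have "closedin (top_of_set ?S) ?F"
    using continuous_closedin_preimage_constant[OF contc] by simp
  then have "compact ?F"
    using closedin_compact compact_sphere by blast
  then obtain A B U V where AB: "A \<union> B = ?F" "A \<noteq> {}" "B \<noteq> {}"
    and UV: "open U" "open V" "U \<inter> V = {}" "A \<subseteq> U" "B \<subseteq> V"
    by (rule compact_disconnected_open_split[OF _ nc])
  have "compact (?S - (U \<union> V))"
    using UV by (intro compact_diff compact_sphere open_Un) 
  then have "compact (c ` (?S - (U \<union> V)))"
    using compact_continuous_image contc continuous_on_subset by (metis Diff_subset)
  moreover have "p \<notin> c ` (?S - (U \<union> V))"
    using AB UV by auto
  ultimately obtain \<epsilon> where "\<epsilon> > 0" and "ball p \<epsilon> \<subseteq> - c ` (?S - (U \<union> V))"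
    by (meson Compl_iff compact_imp_closed open_Compl openE)
  then have \<epsilon>: "\<And>y. y \<in> c ` (?S - (U \<union> V)) \<Longrightarrow> \<epsilon> \<le> dist p y"
    by (metis ComplD mem_ball not_le subsetD)
  have "openin (top_of_set \<Gamma>) (\<Gamma> \<inter> ball p (\<epsilon>/2))" "p \<in> \<Gamma> \<inter> ball p (\<epsilon>/2)"
    using \<open>p \<in> \<Gamma>\<close> \<open>\<epsilon> > 0\<close> by auto
  then obtain N where N: "openin (top_of_set \<Gamma>) N" "connected N" "p \<in> N" "N \<subseteq> \<Gamma> \<inter> ball p (\<epsilon>/2)"
    using lc unfolding locally_connected by meson
  then obtain r where r: "r > 0" "ball p r \<inter> \<Gamma> \<subseteq> N"
    by (metis openin_contains_ball)
  \<comment> \<open>Closeness \<open>r\<close> makes \<open>f n\<close> send the fibre into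
    \<open>N\<close>; closeness \<open>\<epsilon>/2\<close>, added to the radius of
    \<open>N\<close>, keeps the preimage of \<open>N\<close> away from the points outside
    \<open>U \<union> V\<close>.\<close>
  obtain n where n: "\<And>z. z \<in> ?S \<Longrightarrow> dist (f n z) (c z) < min r (\<epsilon>/2)"
    using uniform_limitD[OF lim, of "min r (\<epsilon>/2)"] r \<open>\<epsilon> > 0\<close>
    unfolding eventually_sequentially by (meson half_gt_zero min_less_iff_conj order_refl)
  obtain g where g: "homeomorphism ?S \<Gamma> (f n) g"
    using f by blast
  have "continuous_on N g"
    using g N by (meson continuous_on_subset homeomorphism_def le_inf_iff)
  then have "connected (g ` N)"
    using N connected_continuous_image by blast
  moreover have FN: "?F \<subseteq> g ` N"
  proof
    fix z assume z: "z \<in> ?F"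
    then have "f n z \<in> ball p r \<inter> \<Gamma>"
      using n[of z] g by (auto simp: dist_commute homeomorphism_def)
    then show "z \<in> g ` N"
      using r z homeomorphism_apply1[OF g, of z] by (metis (no_types, lifting) image_eqI mem_Collect_eq subsetD)
  qed
  moreover have "g ` N \<subseteq> U \<union> V"
  proof clarify
    fix y assume y: "y \<in> N" "g y \<notin> V"
    have gy: "g y \<in> ?S" "f n (g y) = y"
      using y N homeomorphism_image2[OF g] homeomorphism_apply2[OF g] by blast+
    have "dist p (c (g y)) \<le> dist p y + dist y (c (g y))"
      by (rule dist_triangle)
    also have "\<dots> < \<epsilon>"
      using n[OF gy(1)] gy(2) y N by (auto simp: subset_iff)
    finally show "g y \<in> U"
      using \<epsilon>[of "c (g y)"] gy(1) y by (meson DiffI UnE imageI not_le)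
  qed
  ultimately have "U \<inter> g ` N = {} \<or> V \<inter> g ` N = {}"
    using UV by (intro connectedD) auto
  moreover have "A \<subseteq> U \<inter> g ` N" "B \<subseteq> V \<inter> g ` N"
    using AB(1) UV FN by auto
  ultimately show False
    using AB by auto
qed

text \<open>A component of \<open>S\<close> that meets a relatively clopen set stays in it. This
  carries hypotheses on components of a preimage over to its part in an open set.\<close>

lemma clopen_component:
  assumes "openin (top_of_set S) R" "closedin (top_of_set S) R" "C \<in> components R"
  shows "C \<in> components S"
proof -
  have RS: "R \<subseteq> S" using assms openin_imp_subset by blast
  have C: "C \<subseteq> R" "C \<noteq> {}" "connected C"
    using assms in_components_subset in_components_nonempty in_components_connected by blast+
  then obtain D where D: "D \<in> components S" "C \<subseteq> D"
    using exists_component_superset[of C S] RS by (metis subset_empty subset_trans)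
  have "D \<subseteq> R"
  proof -
    have DS: "D \<subseteq> S" using D in_components_subset by blast
    obtain W where W: "open W" "R = S \<inter> W"
      using assms(1) by (auto simp: openin_open)
    obtain Z where Z: "closed Z" "R = S \<inter> Z"
      using assms(2) by (auto simp: closedin_closed)
    have "D \<inter> R = D \<inter> W" "D \<inter> R = D \<inter> Z"
      using DS W Z by blast+
    then have "openin (top_of_set D) (D \<inter> R)" "closedin (top_of_set D) (D \<inter> R)"
      using W Z by (metis openin_open_Int, metis closedin_closed_Int)
    then have "D \<inter> R = D"
      using connected_clopen[of D] in_components_connected[OF D(1)] C D by blast
    then show ?thesis by blast
  qed
  then have "D \<subseteq> C"
    using components_maximal[OF assms(3), of D] D C in_components_connected by blast
  with D show ?thesis
    using subset_antisym by blast
qed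

section \<open>Loops around a part of a chord\<close>

text \<open>The points of \<open>U\<close> over \<open>G - T\<close> form an open set
  \<open>V\<close>, and adding the preimage of \<open>T\<close> in \<open>U\<close> gives a compact
  set \<open>Z\<close>. So \<open>V\<close> and the nonempty open set \<open>- Z\<close> partition
  the complement of that preimage, which is connected; hence \<open>V\<close> is empty.\<close>

lemma avoids_enclosed_region:
  fixes w :: "complex \<Rightarrow> 'a::metric_space"
  assumes contw: "continuous_on (cball 0 1) w" and T: "closed T"
    and comps: "\<And>C. C \<in> components {z \<in> cball 0 1. w z \<in> T} \<Longrightarrow> connected (- C)"
    and U: "open U" "U \<subseteq> ball 0 1" and G: "open G" and H: "open H" and GH: "G \<inter> H = {}"
    and fr: "\<And>z. z \<in> frontier U \<Longrightarrow> w z \<in> H - T"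
    and cl: "\<And>z. z \<in> closure U \<Longrightarrow> w z \<in> T \<union> G \<union> H"
    and z: "z \<in> U"
  shows "w z \<notin> G - T"
proof -
  let ?S = "{z \<in> cball 0 1. w z \<in> T}"
  have clU: "closure U \<subseteq> cball (0::complex) 1"
    using U(2) by (meson ball_subset_cball closed_cball closure_minimal subset_trans)
  have Ucl: "closure U = U \<union> frontier U"
    using closure_Un_frontier by blast
  have contU: "continuous_on U w"
    using contw U(2) by (meson ball_subset_cball continuous_on_subset subset_trans)
  have op: "open {z \<in> U. w z \<in> A}" if "open A" for A
    using continuous_open_preimage[OF contU U(1) that] by (simp add: vimage_def Int_def)
  \<comment> \<open>No frontier point of \<open>U\<close> lies over \<open>T\<close>, so the part of
    the preimage in \<open>U\<close> is both relatively open and relatively closed.\<close>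
  have S0: "?S \<inter> U = ?S \<inter> closure U"
    using fr Ucl by auto
  have cS: "closed ?S"
    using continuous_closed_preimage[OF contw closed_cball T] by (simp add: vimage_def Int_def)
  have comps': "connected (- C)" if "C \<in> components (?S \<inter> U)" for C
  proof (rule comps, rule clopen_component[OF _ _ that])
    show "openin (top_of_set ?S) (?S \<inter> U)"
      using U(1) by (rule openin_open_Int)
    show "closedin (top_of_set ?S) (?S \<inter> U)"
      unfolding S0 by (rule closedin_closed_Int) simp
  qed
  \<comment> \<open>A closed planar set fails to separate the plane as soon as none of its
    components separates it.\<close>
  have con: "connected (- (?S \<inter> U))"
  proof -
    have "closed (?S \<inter> U)"
      unfolding S0 using cS by (rule closed_Int) simp
    then show ?thesis
      using nonseparation_by_component_eq[of "?S \<inter> U"] comps' by blast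
  qed
  define V where "V = {z \<in> U. w z \<in> G - T}"
  have oV: "open V"
    unfolding V_def using op[of "G - T"] G T by (simp add: open_Diff)
  define Z where "Z = V \<union> (?S \<inter> U)"
  have Z: "Z = closure U - {z \<in> U. w z \<in> H - T} - frontier U"
  proof
    show "Z \<subseteq> closure U - {z \<in> U. w z \<in> H - T} - frontier U"
      using GH fr closure_subset[of U] U(1)
      by (auto simp: Z_def V_def frontier_def interior_open)
    show "closure U - {z \<in> U. w z \<in> H - T} - frontier U \<subseteq> Z"
      using cl clU by (auto simp: Z_def V_def frontier_def interior_open U(1) subset_iff)
  qed
  \<comment> \<open>The removed set is relatively open in the disc and contains the frontier of
    \<open>U\<close>; hence \<open>Z\<close> is closed.\<close>
  have Z': "Z = closure U - {z \<in> cball 0 1. w z \<in> H - T}"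
    using Z fr cl clU Ucl by auto
  have "openin (top_of_set (cball 0 1)) {z \<in> cball 0 1. w z \<in> H - T}"
    using continuous_openin_preimage_gen[OF contw, of "H - T"] H T
    by (simp add: open_Diff vimage_def Int_def)
  then obtain Q where Q: "open Q" "{z \<in> cball 0 1. w z \<in> H - T} = cball 0 1 \<inter> Q"
    by (auto simp: openin_open)
  have "Z = closure U - Q"
    using Z' Q clU by blast
  then have cZ: "closed Z"
    using Q by (simp add: closed_Diff)
  have bZ: "bounded Z"
    using Z' clU by (meson Diff_subset bounded_cball bounded_subset subset_trans)
  have "- (?S \<inter> U) = V \<union> - Z"
    by (auto simp: Z_def V_def)
  moreover have "V \<inter> - Z = {}"
    by (auto simp: Z_def)
  ultimately have "V = {} \<or> - Z = {}"
    using connectedD[OF con oV, of "- Z"] cZ by auto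
  moreover have "- Z \<noteq> {}"
    using bZ cobounded_imp_unbounded[of Z] by auto
  ultimately show ?thesis
    using z by (auto simp: V_def)
qed

text \<open>The point is \<open>(1 - r) * e + r * p\<close>: the triangle inequality settles
  \<open>r < 1\<close>, the reverse one \<open>r > 1\<close>, and \<open>norm e < 1\<close> makes
  both strict.\<close>

lemma norm_chord:
  fixes e p :: complex
  assumes e: "norm e < 1" and p: "norm p = 1" and r: "0 \<le> r"
  shows "norm (e + of_real r * (p - e)) < 1 \<longleftrightarrow> r < 1"
    and "norm (e + of_real r * (p - e)) \<le> 1 \<longleftrightarrow> r \<le> 1"
proof -
  have eq: "e + of_real r * (p - e) = of_real (1 - r) * e + of_real r * p"
    by (simp add: algebra_simps)
  have lt: "norm (e + of_real r * (p - e)) < 1" if "r < 1"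
  proof -
    have "norm (e + of_real r * (p - e)) \<le> (1 - r) * norm e + r"
      unfolding eq using norm_triangle_ineq[of "of_real (1 - r) * e" "of_real r * p"] that r p
      by (simp add: norm_mult del: of_real_diff)
    also have "\<dots> < (1 - r) * 1 + r"
      using that e by (intro add_strict_right_mono mult_strict_left_mono) auto
    finally show ?thesis by simp
  qed
  have gt: "norm (e + of_real r * (p - e)) > 1" if "r > 1"
  proof -
    have "r - (r - 1) * norm e \<le> norm (e + of_real r * (p - e))"
      unfolding eq using norm_diff_ineq[of "of_real r * p" "of_real (1 - r) * e"] that p
      by (simp add: norm_mult add.commute del: of_real_diff)
    moreover have "(r - 1) * norm e < (r - 1) * 1"
      using that e by (intro mult_strict_left_mono) auto
    ultimately show ?thesis by simp
  qed
  have e1: "norm (e + of_real r * (p - e)) = 1" if "r = 1"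
    using that p by simp
  show "norm (e + of_real r * (p - e)) < 1 \<longleftrightarrow> r < 1" "norm (e + of_real r * (p - e)) \<le> 1 \<longleftrightarrow> r \<le> 1"
    using lt gt e1 by (metis less_irrefl linorder_neqE_linordered_idom less_asym, metis less_irrefl less_le_not_le linorder_neqE_linordered_idom not_le)
qed

text \<open>The tangent at \<open>p\<close> meets the disc in \<open>p\<close> alone, so deleting
  \<open>p\<close> means intersecting with an open half-plane.\<close>

lemma convex_cball_minus_boundary_point:
  fixes p :: complex
  assumes "norm p = 1"
  shows "convex (cball 0 1 - {p})"
proof -
  have "cball 0 1 - {p} = cball 0 1 \<inter> {z. inner p z < 1}"
  proof (intro equalityI subsetI)
    fix z assume z: "z \<in> cball 0 1 - {p}"
    have "inner p z \<noteq> 1"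
    proof
      assume "inner p z = 1"
      then have "(norm (p - z))\<^sup>2 = (norm z)\<^sup>2 - 1"
        using assms by (simp add: power2_norm_eq_inner inner_diff inner_commute norm_eq_1)
      also have "\<dots> \<le> 0"
        using z by (simp add: power_le_one)
      finally show False
        using z by simp
    qed
    moreover have "inner p z \<le> 1"
      using norm_cauchy_schwarz[of p z] assms z by simp
    ultimately show "z \<in> cball 0 1 \<inter> {z. inner p z < 1}"
      using z by auto
  qed (use assms in \<open>auto simp: norm_eq_1\<close>)
  then show ?thesis
    by (simp add: convex_Int convex_halfspace_lt)
qed

text \<open>The loop runs from \<^term>\<open>p * Complex c s\<close> along \<^term>\<open>g\<close> to the mirror image
  \<^term>\<open>p * Complex c (- s)\<close> and returns, outside the disc, along the two tangents at these points,
  which meet in \<^term>\<open>p / of_real c\<close>. Around \<^term>\<open>p\<close> it is homotopic to a triangle, because the disc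
  without \<^term>\<open>p\<close> is convex.\<close>

lemma tangent_loop:
  fixes p :: complex and c s :: real
  assumes p: "norm p = 1" and c: "0 < c" and s: "0 < s" and cs: "c\<^sup>2 + s\<^sup>2 = 1"
    and g: "path g" "pathstart g = p * Complex c s" "pathfinish g = p * Complex c (- s)"
    and gp: "path_image g \<subseteq> cball 0 1 - {p}"
  defines "L \<equiv> path_image g \<union> closed_segment (p * Complex c (- s)) (p / of_real c)
                 \<union> closed_segment (p / of_real c) (p * Complex c s)"
  shows "L \<inter> cball 0 1 = path_image g" and "p \<in> inside L"
proof -
  let ?n1 = "p * Complex c s" and ?n2 = "p * Complex c (- s)" and ?m = "p / of_real c"
  have p0: "p \<noteq> 0" using p by auto
  \<comment> \<open>With \<open>n\<close> factored out, a point of the tangent segment is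
    \<open>n * Complex 1 (u * d)\<close>, whose norm exceeds 1 unless \<open>u = 0\<close>.\<close>
  have m1: "?m = ?n1 * Complex 1 (- (s/c))" and m2: "?m = ?n2 * Complex 1 (s/c)"
    using c cs by (auto simp: complex_eq_iff field_simps power2_eq_square)
  have out: "z = n" if zseg: "z \<in> closed_segment n ?m" and z: "norm z \<le> 1" and n: "norm n = 1"
    and m: "?m = n * Complex 1 d" and d: "d \<noteq> 0" for z n d
  proof -
    obtain u where u: "0 \<le> u" "u \<le> 1" "z = (1 - u) *\<^sub>R n + u *\<^sub>R ?m"
      using zseg by (auto simp: closed_segment_def)
    have "z = n * Complex 1 (u * d)"
      unfolding u(3) m by (simp add: complex_eq_iff algebra_simps)
    then have "(norm z)\<^sup>2 = 1 + (u * d)\<^sup>2"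
      using n by (simp add: norm_mult cmod_power2)
    moreover have "(norm z)\<^sup>2 \<le> 1"
      using z by (simp add: power_le_one)
    ultimately have "u * d = 0"
      by (smt (verit) zero_less_power2)
    then show ?thesis
      using u d by simp
  qed
  have nn: "norm ?n1 = 1" "norm ?n2 = 1"
    using p cs by (auto simp: norm_mult complex_norm)
  have ends: "?n1 \<in> path_image g" "?n2 \<in> path_image g"
    using g by (metis pathstart_in_path_image, metis pathfinish_in_path_image)
  show LD: "L \<inter> cball 0 1 = path_image g"
  proof
    show "L \<inter> cball 0 1 \<subseteq> path_image g"
    proof
      fix z assume z: "z \<in> L \<inter> cball 0 1"
      then have z1: "norm z \<le> 1" by simp
      have "z = ?n2" if "z \<in> closed_segment ?n2 ?m"
        using out[OF that z1 nn(2) m2] c s by simp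
      moreover have "z = ?n1" if "z \<in> closed_segment ?m ?n1"
        using out[OF _ z1 nn(1) m1] that c s by (simp add: closed_segment_commute)
      ultimately show "z \<in> path_image g"
        using z ends unfolding L_def by blast
    qed
    show "path_image g \<subseteq> L \<inter> cball 0 1"
      using gp by (auto simp: L_def)
  qed
  define \<gamma> where "\<gamma> = g +++ linepath ?n2 ?m +++ linepath ?m ?n1"
  have pg: "path \<gamma>" "pathfinish \<gamma> = pathstart \<gamma>" and img: "path_image \<gamma> = L"
    using g by (auto simp: \<gamma>_def L_def path_image_join Un_assoc)
  have pL: "p \<notin> L"
    using LD gp p by auto
  have "homotopic_paths (- {p}) g (linepath ?n1 ?n2)"
  proof (rule homotopic_paths_linear)
    fix t :: real assume t: "t \<in> {0..1}"
    have "closed_segment ?n1 ?n2 \<subseteq> cball 0 1 - {p}"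
      using ends gp by (intro closed_segment_subset convex_cball_minus_boundary_point p) auto
    then have "linepath ?n1 ?n2 t \<in> cball 0 1 - {p}"
      using t linepath_in_path by blast
    moreover have "g t \<in> cball 0 1 - {p}"
      using t gp unfolding path_image_def by blast
    ultimately have "closed_segment (g t) (linepath ?n1 ?n2 t) \<subseteq> cball 0 1 - {p}"
      by (intro closed_segment_subset convex_cball_minus_boundary_point p)
    then show "closed_segment (g t) (linepath ?n1 ?n2 t) \<subseteq> - {p}"
      by blast
  qed (use g in auto)
  moreover have "homotopic_paths (- {p}) (linepath ?n2 ?m +++ linepath ?m ?n1) (linepath ?n2 ?m +++ linepath ?m ?n1)"
    using pL by (auto simp: homotopic_paths_refl path_image_join L_def)
  ultimately have "homotopic_paths (- {p}) \<gamma> (linepath ?n1 ?n2 +++ linepath ?n2 ?m +++ linepath ?m ?n1)"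
    unfolding \<gamma>_def by (rule homotopic_paths_join) (use g in auto)
  then have wn: "winding_number \<gamma> p = winding_number (linepath ?n1 ?n2 +++ linepath ?n2 ?m +++ linepath ?m ?n1) p"
    by (rule winding_number_homotopic_paths)
  have ncol: "\<not> collinear {?n1, ?n2, ?m}"
  proof
    assume "collinear {?n1, ?n2, ?m}"
    then have "collinear {?n1, ?m, ?n2}"
      by (simp add: insert_commute)
    then have "collinear {0, ?n1 - ?m, ?n2 - ?m}"
      by (simp add: collinear_3)
    moreover have d1: "?n1 - ?m = (p * of_real (s/c)) * Complex (- s) c"
      unfolding m1 using c by (simp add: complex_eq_iff field_simps)
    moreover have d2: "?n2 - ?m = (p * of_real (s/c)) * Complex (- s) (- c)"
      unfolding m2 using c by (simp add: complex_eq_iff field_simps)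
    moreover have f0: "p * of_real (s/c) \<noteq> 0"
      using p0 s c by simp
    ultimately obtain k where "?n2 - ?m = k *\<^sub>R (?n1 - ?m)"
      using c by (auto simp: collinear_lemma complex_eq_iff)
    then have "(p * of_real (s/c)) * Complex (- s) (- c) = (p * of_real (s/c)) * (k *\<^sub>R Complex (- s) c)"
      unfolding d1 d2 by (simp add: scaleR_conv_of_real mult_ac)
    then have "Complex (- s) (- c) = k *\<^sub>R Complex (- s) c"
      using f0 mult_cancel_left by blast
    then show False
      using s c by (auto simp: complex_eq_iff)
  qed
  have "p \<in> interior (convex hull {?n1, ?n2, ?m})"
  proof -
    \<comment> \<open>The barycentric coordinates of \<open>p\<close> in the triangle are
      \<open>k/2\<close>, \<open>k/2\<close> and \<open>c * k\<close>; their sum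
      \<open>k + c * k\<close> is 1 for this \<open>k\<close>.\<close>
    define k where "k = 1 / (1 + c)"
    have k: "k > 0" "k + c * k = 1"
      using c by (auto simp: k_def add_divide_distrib[symmetric])
    have "(k/2) *\<^sub>R ?n1 + (k/2) *\<^sub>R ?n2 + (c * k) *\<^sub>R ?m = p * of_real (k + c * k)"
      using c by (auto simp: complex_eq_iff algebra_simps)
    then have "(k/2) *\<^sub>R ?n1 + (k/2) *\<^sub>R ?n2 + (c * k) *\<^sub>R ?m = p"
      unfolding k(2) by simp
    moreover have "0 < k/2" "0 < c * k" "k/2 + k/2 + c * k = 1"
      using c k by auto
    ultimately show ?thesis
      unfolding interior_convex_hull_3_minimal[OF ncol DIM_complex] by blast
  qed
  \<comment> \<open>The winding number of a triangle about an interior point is 1 or -1, whereas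
    that of a closed path vanishes outside its image.\<close>
  then have "winding_number \<gamma> p \<noteq> 0"
    unfolding wn winding_number_triangle[OF \<open>p \<in> _\<close>] by simp
  then have "p \<notin> outside L"
    using winding_number_zero_in_outside[OF pg] img by auto
  then show "p \<in> inside L"
    using pL inside_Un_outside[of L] by blast
qed

text \<open>The end points are fixed before \<open>g\<close>, so that \<open>g\<close> can later be
  chosen with a good preimage. The loop is that of \<open>tangent_loop\<close>: the connected set
  \<open>K\<close> misses it and contains \<open>p\<close>, so all of \<open>K\<close> is inside;
  the loop lies in the convex set \<open>W\<close>, so the complement of \<open>W\<close> is
  outside.\<close>

lemma enclosing_loop:
  fixes K :: "complex set"
  assumes K: "connected K" "K \<subseteq> cball 0 1" "K \<inter> sphere 0 1 = {p}"
    and W: "open W" "convex W" "K \<subseteq> W"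
  obtains n1 n2 where "n1 \<noteq> n2" "{n1, n2} \<subseteq> cball 0 1 \<inter> W - K"
    "\<And>g. path g \<Longrightarrow> pathstart g = n1 \<Longrightarrow> pathfinish g = n2 \<Longrightarrow> path_image g \<subseteq> cball 0 1 \<inter> W - K \<Longrightarrow>
       \<exists>L. closed L \<and> L \<inter> cball 0 1 = path_image g \<and> K \<subseteq> inside L \<and> - W \<subseteq> outside L"
proof -
  have p: "norm p = 1" "p \<in> K" "p \<in> W" using K W by auto
  let ?s = "\<lambda>c. sqrt (1 - c\<^sup>2)"
  \<comment> \<open>As \<open>c\<close> tends to 1 from below, both points of tangency and the
    intersection of the tangents tend to \<open>p\<close>, so they are eventually in
    \<open>W\<close>.\<close>
  have "((\<lambda>c. p * Complex c (?s c)) \<longlongrightarrow> p * Complex 1 (?s 1)) (at_left 1)"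
       "((\<lambda>c. p * Complex c (- ?s c)) \<longlongrightarrow> p * Complex 1 (- ?s 1)) (at_left 1)"
       "((\<lambda>c. p / of_real c) \<longlongrightarrow> p / of_real 1) (at_left 1)"
    by (intro tendsto_intros; simp)+
  then have "\<forall>\<^sub>F c in at_left 1. p * Complex c (?s c) \<in> W"
       "\<forall>\<^sub>F c in at_left 1. p * Complex c (- ?s c) \<in> W"
       "\<forall>\<^sub>F c in at_left 1. p / of_real c \<in> W"
    using topological_tendstoD[OF _ W(1)] p(3) by (simp_all add: one_complex.code[symmetric])
  moreover have "\<forall>\<^sub>F c in at_left (1::real). c \<in> {0<..<1}"
    by (rule eventually_at_left_real) simp
  ultimately have "\<forall>\<^sub>F c in at_left 1. c \<in> {0<..<1} \<and> p * Complex c (?s c) \<in> W \<and> p * Complex c (- ?s c) \<in> W \<and> p / of_real c \<in> W"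
    by eventually_elim auto
  then obtain c where c: "0 < c" "c < 1" and inW: "p * Complex c (?s c) \<in> W" "p * Complex c (- ?s c) \<in> W" "p / of_real c \<in> W"
    by (elim eventually_happens'[OF trivial_limit_at_left_real, THEN exE]) auto
  define s where "s = ?s c"
  have "c\<^sup>2 < 1" using c by (simp add: power_less_one_iff)
  then have s: "s > 0" "c\<^sup>2 + s\<^sup>2 = 1" by (auto simp: s_def)
  let ?n1 = "p * Complex c s" and ?n2 = "p * Complex c (- s)" and ?m = "p / of_real c"
  have p0: "p \<noteq> 0" using p by auto
  have nn: "norm ?n1 = 1" "norm ?n2 = 1"
    using p s by (auto simp: norm_mult complex_norm)
  have "?n1 \<noteq> p" "?n2 \<noteq> p" "?n1 \<noteq> ?n2"
    using p0 s by (auto simp: complex_eq_iff[of "Complex _ _"] mult_cancel_left1 mult_cancel_left)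
  moreover have "z \<notin> K" if "norm z = 1" "z \<noteq> p" for z
    using K(3) that mem_sphere_0[of z 1] by blast
  ultimately have "?n1 \<notin> K" "?n2 \<notin> K" "?n1 \<noteq> ?n2"
    using nn by blast+
  show ?thesis
  proof
    show "?n1 \<noteq> ?n2" by fact
    show "{?n1, ?n2} \<subseteq> cball 0 1 \<inter> W - K"
      using nn inW \<open>?n1 \<notin> K\<close> \<open>?n2 \<notin> K\<close> by (auto simp: s_def)
    fix g assume g: "path g" "pathstart g = ?n1" "pathfinish g = ?n2" and gim: "path_image g \<subseteq> cball 0 1 \<inter> W - K"
    define L where "L = path_image g \<union> closed_segment ?n2 ?m \<union> closed_segment ?m ?n1"
    have gp: "path_image g \<subseteq> cball 0 1 - {p}"
      using gim p by auto
    have LD: "L \<inter> cball 0 1 = path_image g" and pL: "p \<in> inside L"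
      unfolding L_def using tangent_loop[OF p(1) c(1) s g gp] by auto
    have "closed L"
      unfolding L_def using g by (intro closed_Un closed_path_image closed_segment)
    moreover have "K \<subseteq> inside L"
    proof
      fix z assume z: "z \<in> K"
      have "K \<subseteq> - L"
        using LD gim K(2) by blast
      then have "connected_component (- L) p z"
        using K(1) z p(2) by (meson connected_component_def)
      then show "z \<in> inside L"
        using pL inside_same_component by blast
    qed
    moreover have "L \<subseteq> W"
      using inW gim W(2) closed_segment_subset[of _ W] by (auto simp: L_def s_def)
    then have "- W \<subseteq> outside L"
      using outside_subset_convex W(2) by blast
    ultimately show "\<exists>L. closed L \<and> L \<inter> cball 0 1 = path_image g \<and> K \<subseteq> inside L \<and> - W \<subseteq> outside L"
      using LD by blast
  qed
qed

section \<open>Geometry of chords and rays in the disc\<close>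

definition chord_part :: "complex \<Rightarrow> complex \<Rightarrow> real \<Rightarrow> complex set" where
  "chord_part e p s = (\<lambda>r. e + of_real r * (p - e)) ` {s..1}"

lemma chord_part_basic:
  assumes e: "norm e < 1" and p: "norm p = 1" and s: "0 < s" "s \<le> 1"
  shows "compact (chord_part e p s)" "convex (chord_part e p s)" "chord_part e p s \<subseteq> cball 0 1"
    "chord_part e p s \<inter> sphere 0 1 = {p}"
proof -
  show "compact (chord_part e p s)"
    unfolding chord_part_def by (intro compact_continuous_image continuous_intros) auto
  show "convex (chord_part e p s)"
  proof (rule convexI)
    fix x y and u v :: real
    assume xy: "x \<in> chord_part e p s" "y \<in> chord_part e p s" and uv: "0 \<le> u" "0 \<le> v" "u + v = 1"
    obtain r r' where r: "r \<in> {s..1}" "r' \<in> {s..1}"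
      "x = e + of_real r * (p - e)" "y = e + of_real r' * (p - e)"
      using xy by (auto simp: chord_part_def)
    have "u *\<^sub>R x + v *\<^sub>R y = of_real (u + v) * e + of_real (u * r + v * r') * (p - e)"
      by (simp add: r scaleR_conv_of_real algebra_simps)
    also have "\<dots> = e + of_real (u * r + v * r') * (p - e)"
      by (simp only: uv of_real_1 mult_1)
    finally have "u *\<^sub>R x + v *\<^sub>R y = e + of_real (u * r + v * r') * (p - e)" .
    moreover have "u * r + v * r' \<in> {s..1}"
      using convexD[OF convex_real_interval(5) r(1,2) uv] by simp
    ultimately show "u *\<^sub>R x + v *\<^sub>R y \<in> chord_part e p s"
      unfolding chord_part_def by blast
  qed
  show "chord_part e p s \<subseteq> cball 0 1"
    using norm_chord(2)[OF e p] s by (auto simp: chord_part_def)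
  show "chord_part e p s \<inter> sphere 0 1 = {p}"
  proof (intro equalityI subsetI)
    fix z assume "z \<in> chord_part e p s \<inter> sphere 0 1"
    then obtain r where r: "s \<le> r" "r \<le> 1" "z = e + of_real r * (p - e)" "norm z = 1"
      by (auto simp: chord_part_def)
    then have "\<not> r < 1"
      using norm_chord(1)[OF e p, of r] s by simp
    then show "z \<in> {p}"
      using r by simp
  next
    fix z assume "z \<in> {p}"
    then have "z = e + of_real 1 * (p - e)"
      by simp
    then have "z \<in> chord_part e p s"
      unfolding chord_part_def using s by (intro image_eqI[where x = 1]) auto
    then show "z \<in> chord_part e p s \<inter> sphere 0 1"
      using p \<open>z \<in> {p}\<close> by simp
  qed
qed

text \<open>The centre \<open>a\<close> lies on the line of the chord just before its inner end. If
  the segment from \<open>a\<close> to \<open>z\<close> meets the chord part, then \<open>z\<close>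
  is farther out on the same line, and being in the disc it belongs to the chord part
  itself.\<close>

lemma starlike_minus_chord_part:
  assumes e: "norm e < 1" and p: "norm p = 1" and s: "0 \<le> s'" "s' < s" "s \<le> 1"
    and W: "convex W" "e + of_real s' * (p - e) \<in> W"
  shows "starlike (cball 0 1 \<inter> W - chord_part e p s)"
proof -
  define K where "K = chord_part e p s"
  define a where "a = e + of_real s' * (p - e)"
  have ep: "p - e \<noteq> 0" using e p by auto
  have "norm a \<le> 1"
    using norm_chord(2)[OF e p s(1)] s by (simp add: a_def)
  moreover have "a \<notin> K"
  proof
    assume "a \<in> K"
    then obtain r where "s \<le> r" "of_real s' * (p - e) = of_real r * (p - e)"
      by (auto simp: a_def K_def chord_part_def)
    then show False
      using ep s by simp
  qed
  ultimately have "a \<in> cball 0 1 \<inter> W - K"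
    using W by (simp add: a_def)
  moreover have "closed_segment a z \<subseteq> cball 0 1 \<inter> W - K" if z: "z \<in> cball 0 1 \<inter> W - K" for z
  proof
    fix y assume y: "y \<in> closed_segment a z"
    have "y \<in> cball 0 1 \<inter> W"
      using closed_segment_subset[of a "cball 0 1 \<inter> W" z] y z \<open>a \<in> _\<close> W by (auto simp: convex_Int)
    moreover have "y \<notin> K"
    proof
      assume "y \<in> K"
      then obtain r where r: "s \<le> r" "r \<le> 1" "y = e + of_real r * (p - e)"
        by (auto simp: K_def chord_part_def)
      obtain u where u: "0 \<le> u" "u \<le> 1" "y = (1 - u) *\<^sub>R a + u *\<^sub>R z"
        using y by (auto simp: closed_segment_def)
      have "u \<noteq> 0"
        using u(3) \<open>y \<in> K\<close> \<open>a \<notin> K\<close> by auto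
      \<comment> \<open>The parameter of \<open>z\<close> on the line, solved from
        \<open>(1 - u) * s' + u * t = r\<close>.\<close>
      define t where "t = s' + (r - s') / u"
      have tu: "u * t = r - (1 - u) * s'"
        using \<open>u \<noteq> 0\<close> by (simp add: t_def field_simps)
      have "of_real u * z = y - of_real (1 - u) * a"
        using u(3) by (simp add: scaleR_conv_of_real)
      also have "\<dots> = of_real u * e + of_real (r - (1 - u) * s') * (p - e)"
        by (simp add: r(3) a_def algebra_simps)
      also have "\<dots> = of_real u * (e + of_real t * (p - e))"
        by (simp only: tu[symmetric] of_real_mult distrib_left mult.assoc)
      finally have zt: "z = e + of_real t * (p - e)"
        using \<open>u \<noteq> 0\<close> by simp
      have "(r - s') * 1 \<le> (r - s') * (1 / u)"
        using u \<open>u \<noteq> 0\<close> r s by (intro mult_left_mono) (auto simp: field_simps)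
      then have "r \<le> t"
        by (simp add: t_def)
      then have "s \<le> t" "0 \<le> t"
        using r s by auto
      moreover have "t \<le> 1"
        using z zt norm_chord(2)[OF e p \<open>0 \<le> t\<close>] by simp
      ultimately have "z \<in> K"
        unfolding K_def chord_part_def zt by (intro imageI) simp
      then show False using z by blast
    qed
    ultimately show "y \<in> cball 0 1 \<inter> W - K" by blast
  qed
  ultimately show ?thesis
    unfolding starlike_def K_def by blast
qed

lemma same_ray_eq:
  fixes p p' q :: complex
  assumes q: "norm q < 1" and p: "norm p = 1" and p': "norm p' = 1"
    and r: "0 < r" "0 \<le> t" "of_real r * (p - q) = of_real t * (p' - q)"
  shows "p = p'"
proof -
  have t: "t \<noteq> 0"
    using r p q by auto
  have "p' - q = of_real (r / t) * (p - q)"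
    using r(3) t by (simp add: field_simps)
  then have eq: "p' = q + of_real (r / t) * (p - q)"
    by (simp add: algebra_simps)
  have "r / t = 1"
    using norm_chord[OF q p, of "r / t"] r t p' unfolding eq[symmetric] by auto
  then show ?thesis
    using eq by simp
qed

lemma ray_to_circle:
  fixes q x :: complex
  assumes q: "norm q < 1" and x: "x \<in> cball 0 1" "x \<noteq> q"
  obtains p t where "norm p = 1" "1 \<le> t" "x = q + of_real (1 / t) * (p - q)"
proof -
  \<comment> \<open>At parameter \<open>B\<close> the ray is at distance at least 2 from
    \<open>q\<close>, hence no longer in the open disc; the maximum with 1 keeps
    \<open>{1..B}\<close> nonempty.\<close>
  define B where "B = max 1 (2 / norm (x - q))"
  have "2 = 2 / norm (x - q) * norm (x - q)"
    using x by simp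
  also have "\<dots> \<le> B * norm (x - q)"
    by (rule mult_right_mono) (auto simp: B_def)
  also have "\<dots> = norm (of_real B * (x - q))"
    by (simp add: norm_mult B_def)
  also have "\<dots> \<le> norm (q + of_real B * (x - q)) + norm q"
    using norm_triangle_ineq4[of "q + of_real B * (x - q)" q] by simp
  finally have "1 \<le> norm (q + of_real B * (x - q))"
    using q by simp
  moreover have "norm (q + of_real 1 * (x - q)) \<le> 1" "1 \<le> B"
    using x by (auto simp: B_def)
  moreover have "continuous_on {1..B} (\<lambda>t. norm (q + of_real t * (x - q)))"
    by (intro continuous_intros)
  ultimately obtain t where "1 \<le> t" "norm (q + of_real t * (x - q)) = 1"
    using IVT'[of "\<lambda>t. norm (q + of_real t * (x - q))" 1 1 B] by blast
  then show ?thesis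
    by (intro that[of "q + of_real t * (x - q)" t]) auto
qed

text \<open>Moving the base point back along the line turns the full segment from \<open>q\<close>
  into a chord part with \<open>s > 0\<close>, as required for room in the disc behind its inner
  end.\<close>

lemma chord_part_0:
  assumes q: "norm q < 1" and p: "norm p = 1"
  shows "\<exists>e s. norm e < 1 \<and> 0 < s \<and> s \<le> 1 \<and> chord_part q p 0 = chord_part e p s"
proof -
  \<comment> \<open>Since \<open>norm (p - q) \<le> 2\<close>, this shift uses at most half of the
    distance from \<open>q\<close> to the circle.\<close>
  define k where "k = (1 - norm q) / 4"
  have k: "k > 0" using q by (simp add: k_def)
  define e where "e = q - of_real k * (p - q)"
  \<comment> \<open>The parameter at which the chord from \<open>e\<close> passes through
    \<open>q\<close>.\<close>
  define s where "s = k / (1 + k)"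
  have "norm e \<le> norm q + k * norm (p - q)"
    using norm_triangle_ineq4[of q "of_real k * (p - q)"] k by (simp add: e_def norm_mult)
  also have "\<dots> \<le> norm q + k * 2"
    using norm_triangle_ineq4[of p q] p q k by (intro add_left_mono mult_left_mono) auto
  also have "\<dots> < 1"
    using q by (simp add: k_def field_simps)
  finally have e: "norm e < 1" .
  have par: "e + of_real r * (p - e) = q + of_real (r * (1 + k) - k) * (p - q)" for r
    by (simp add: e_def algebra_simps)
  have "(\<lambda>r. r * (1 + k) - k) ` {s..1} = {0..1}"
  proof (intro equalityI subsetI)
    fix t assume "t \<in> (\<lambda>r. r * (1 + k) - k) ` {s..1}"
    then obtain r where r: "k / (1 + k) \<le> r" "r \<le> 1" "t = r * (1 + k) - k"
      by (auto simp: s_def)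
    have "k \<le> r * (1 + k)"
      using r(1) k by (simp add: divide_le_eq)
    moreover have "r * (1 + k) \<le> 1 * (1 + k)"
      using r k by (intro mult_right_mono) auto
    ultimately show "t \<in> {0..1}"
      using r by simp
  next
    fix t :: real assume t: "t \<in> {0..1}"
    show "t \<in> (\<lambda>r. r * (1 + k) - k) ` {s..1}"
      by (rule image_eqI[of _ _ "(t + k) / (1 + k)"]) (use t k in \<open>auto simp: s_def divide_right_mono\<close>)
  qed
  then have "chord_part q p 0 = (\<lambda>t. q + of_real t * (p - q)) ` (\<lambda>r. r * (1 + k) - k) ` {s..1}"
    by (simp add: chord_part_def)
  also have "\<dots> = chord_part e p s"
    by (simp add: chord_part_def image_image par)
  finally show ?thesis
    using e k by (intro exI[of _ e] exI[of _ s]) (auto simp: s_def)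
qed

section \<open>Self-maps of the disc with nonseparating preimages of arcs\<close>

text \<open>What remains of the hypotheses after transport along \<open>h\<close>: the metric of
  \<open>X\<close> and cell-likeness enter only through \<open>arcs\<close>, as paths in the disc
  whose preimages have nonseparating components.\<close>

locale disc_map =
  fixes w :: "complex \<Rightarrow> complex"
  assumes cont: "continuous_on (cball 0 1) w"
    and range: "w ` cball 0 1 = cball 0 1"
    and boundary: "w ` sphere 0 1 = sphere 0 1"
    and boundary_fibre: "\<And>p. p \<in> sphere 0 1 \<Longrightarrow> connected {z \<in> sphere 0 1. w z = p}"
    and arcs: "\<And>S a b. openin (top_of_set (cball 0 1)) S \<Longrightarrow> connected S \<Longrightarrow> a \<in> S \<Longrightarrow> b \<in> S \<Longrightarrow> a \<noteq> b \<Longrightarrow>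
       \<exists>g. path g \<and> pathstart g = a \<and> pathfinish g = b \<and> path_image g \<subseteq> S \<and>
         (\<forall>C \<in> components {z \<in> cball 0 1. w z \<in> path_image g}. connected (- C))"
begin

lemma compact_vimage:
  assumes "closed T"
  shows "compact {z \<in> cball 0 1. w z \<in> T}"
proof -
  have "closed (cball 0 1 \<inter> w -` T)"
    using continuous_closed_preimage[OF cont closed_cball assms] .
  then have "compact (cball 0 1 \<inter> (cball 0 1 \<inter> w -` T))"
    by (intro compact_Int_closed compact_cball)
  then show ?thesis
    by (simp add: vimage_def Int_def)
qed

text \<open>A path \<open>g\<close> from \<open>arcs\<close>, close to the chord part, completes to
  a loop with the chord part inside and the image of the frontier of \<open>U\<close> outside. Then
  \<open>avoids_enclosed_region\<close> applies with the two sides of the loop.\<close>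

lemma avoids_chord_part:
  assumes e: "norm e < 1" and p: "norm p = 1" and s: "0 < s" "s \<le> 1"
    and U: "open U" "U \<subseteq> ball 0 1" and fr: "w ` frontier U \<inter> chord_part e p s = {}"
    and z: "z \<in> U"
  shows "w z \<notin> chord_part e p s"
proof
  define K where "K = chord_part e p s"
  note Kb = chord_part_basic[OF e p s, folded K_def]
  assume wz: "w z \<in> chord_part e p s"
  have clU: "closure U \<subseteq> cball (0::complex) 1"
    using U(2) by (meson ball_subset_cball closed_cball closure_minimal subset_trans)
  then have frU: "frontier U \<subseteq> cball 0 1"
    unfolding frontier_def by blast
  have "compact (frontier U)"
    using frU bounded_subset[OF bounded_cball] by (simp add: compact_eq_bounded_closed)
  then have "closed (w ` frontier U)"
    using compact_continuous_image[OF continuous_on_subset[OF cont frU]] compact_imp_closed by blast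
  then obtain \<delta> where d: "\<delta> > 0" "\<And>x y. x \<in> K \<Longrightarrow> y \<in> w ` frontier U \<Longrightarrow> \<delta> \<le> dist x y"
    using separate_compact_closed[OF Kb(1)] fr by (metis K_def inf_commute)
  \<comment> \<open>The \<open>\<delta>\<close>-neighbourhood of \<open>K\<close>, written as a sum
    with a ball, which makes it open and convex.\<close>
  define W where "W = (\<Union>x\<in>K. \<Union>y\<in>ball 0 \<delta>. {x + y})"
  have W: "open W" "convex W"
    unfolding W_def by (auto intro: open_sums convex_sums Kb)
  have inW: "y \<in> W" if "x \<in> K" "dist x y < \<delta>" for x y
    unfolding W_def using that
    by (intro UN_I[of x] UN_I[of "y - x"]) (auto simp: dist_norm norm_minus_commute)
  have KW: "K \<subseteq> W"
    using inW d by force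
  have frW: "w ` frontier U \<subseteq> - W"
  proof clarify
    fix x assume x: "x \<in> frontier U" "w x \<in> W"
    then obtain k y where "k \<in> K" "norm y < \<delta>" "w x = k + y"
      by (auto simp: W_def)
    moreover have "w x \<in> w ` frontier U"
      using x by blast
    ultimately show False
      using d(2)[of k "w x"] by (simp add: dist_norm)
  qed
  \<comment> \<open>The star centre: moving back by at most \<open>\<delta> / 4\<close> along a
    vector of length at most 2 stays within \<open>\<delta>\<close> of \<open>K\<close>.\<close>
  define s' where "s' = max 0 (s - \<delta> / 4)"
  have s': "0 \<le> s'" "s' < s" "s - s' \<le> \<delta> / 4"
    using s d by (auto simp: s'_def max_def)
  have "e + of_real s' * (p - e) \<in> W"
  proof (rule inW)
    show "e + of_real s * (p - e) \<in> K"
      unfolding K_def chord_part_def using s by auto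
    have "dist (e + of_real s * (p - e)) (e + of_real s' * (p - e)) = norm (of_real (s - s') * (p - e))"
      by (simp add: dist_norm algebra_simps)
    also have "\<dots> = (s - s') * norm (p - e)"
      using s' by (simp add: norm_mult del: of_real_diff)
    also have "\<dots> \<le> \<delta> / 4 * 2"
      using s' d norm_triangle_ineq4[of p e] e p by (intro mult_mono) auto
    finally show "dist (e + of_real s * (p - e)) (e + of_real s' * (p - e)) < \<delta>"
      using d by simp
  qed
  then have "starlike (cball 0 1 \<inter> W - K)"
    unfolding K_def using W s' s starlike_minus_chord_part[OF e p] by blast
  then have conn: "connected (cball 0 1 \<inter> W - K)"
    by (rule starlike_imp_connected)
  have "open (W - K)"
    using W Kb(1) by (simp add: open_Diff compact_imp_closed)
  then have "openin (top_of_set (cball 0 1)) (cball 0 1 \<inter> (W - K))"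
    by (rule openin_open_Int)
  then have op: "openin (top_of_set (cball 0 1)) (cball 0 1 \<inter> W - K)"
    by (simp add: Int_Diff)
  obtain n1 n2 where n: "n1 \<noteq> n2" "{n1, n2} \<subseteq> cball 0 1 \<inter> W - K" and
    loop: "\<And>g. path g \<Longrightarrow> pathstart g = n1 \<Longrightarrow> pathfinish g = n2 \<Longrightarrow> path_image g \<subseteq> cball 0 1 \<inter> W - K \<Longrightarrow>
       \<exists>L. closed L \<and> L \<inter> cball 0 1 = path_image g \<and> K \<subseteq> inside L \<and> - W \<subseteq> outside L"
    using enclosing_loop[OF convex_connected[OF Kb(2)] Kb(3,4) W KW] by blast
  have n': "n1 \<in> cball 0 1 \<inter> W - K" "n2 \<in> cball 0 1 \<inter> W - K"
    using n(2) by blast+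
  obtain g where g: "path g" "pathstart g = n1" "pathfinish g = n2" "path_image g \<subseteq> cball 0 1 \<inter> W - K"
    and comps: "\<And>C. C \<in> components {z \<in> cball 0 1. w z \<in> path_image g} \<Longrightarrow> connected (- C)"
    using arcs[OF op conn n' n(1)] by metis
  obtain L where L: "closed L" "L \<inter> cball 0 1 = path_image g" "K \<subseteq> inside L" "- W \<subseteq> outside L"
    using loop[OF g] by blast
  have "w z \<notin> inside L - path_image g"
  proof (rule avoids_enclosed_region[OF cont closed_path_image[OF g(1)] comps U])
    show "open (inside L)" "open (outside L)"
      using L(1) by (auto intro: open_inside open_outside)
    show "inside L \<inter> outside L = {}"
      by (rule inside_Int_outside)
    show "w x \<in> outside L - path_image g" if "x \<in> frontier U" for x
      using that frW L(4) g(4) by blast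
    \<comment> \<open>Within the disc the loop consists of \<open>g\<close> alone, so
      \<open>g\<close> and its two sides cover the disc.\<close>
    show "w x \<in> path_image g \<union> inside L \<union> outside L" if "x \<in> closure U" for x
    proof -
      have "w x \<in> cball 0 1"
        using that clU range by blast
      moreover have "w x \<in> inside L \<union> outside L \<or> w x \<in> L"
        using inside_Un_outside[of L] by blast
      ultimately show ?thesis
        using L(2) by blast
    qed
  qed (use z in auto)
  moreover have "w z \<in> K"
    using wz by (simp add: K_def)
  ultimately show False
    using L(3) g(4) by blast
qed

text \<open>In a splitting of the preimage, the connected circle fibre over \<open>p\<close> lies in
  one piece. The other piece is interior to the disc and has an open neighbourhood whose frontier
  misses the preimage, against \<open>avoids_chord_part\<close>.\<close>

lemma connected_vimage_chord_part:
  assumes e: "norm e < 1" and p: "norm p = 1" and s: "0 < s" "s \<le> 1"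
  shows "connected {z \<in> cball 0 1. w z \<in> chord_part e p s}"
proof (rule ccontr)
  define K where "K = chord_part e p s"
  note Kb = chord_part_basic[OF e p s, folded K_def]
  let ?F = "{z \<in> cball 0 1. w z \<in> K}"
  let ?E = "{z \<in> sphere 0 1. w z = p}"
  assume "\<not> connected {z \<in> cball 0 1. w z \<in> chord_part e p s}"
  then have nc: "\<not> connected ?F" by (simp add: K_def)
  have "compact ?F"
    by (intro compact_vimage compact_imp_closed Kb)
  then obtain A B V U where AB: "A \<union> B = ?F" "A \<noteq> {}" "B \<noteq> {}" "closed A" "closed B"
    and VU: "open V" "open U" "V \<inter> U = {}" "A \<subseteq> V" "B \<subseteq> U"
    by (rule compact_disconnected_open_split[OF _ nc])
  \<comment> \<open>The circle is mapped to the circle, which the chord part meets only in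
    \<open>p\<close>.\<close>
  have sphF: "z \<in> ?E" if "z \<in> ?F" "z \<in> sphere 0 1" for z
  proof -
    have "w z \<in> K \<inter> sphere 0 1"
      using that boundary by blast
    then show ?thesis
      using that Kb(4) by blast
  qed
  have EF: "?E \<subseteq> ?F"
    using Kb(4) by auto
  \<comment> \<open>Stated for arbitrary pieces, since it is applied with either one as the piece
    off the circle.\<close>
  have split: False if AB: "A \<union> B = ?F" "B \<noteq> {}" and VU: "open V" "open U" "V \<inter> U = {}" "A \<subseteq> V" "B \<subseteq> U"
    and EA: "?E \<inter> B = {}" for A B V U
  proof -
    have "B \<inter> sphere 0 1 = {}"
      using sphF EA AB(1) by blast
    moreover have "B \<subseteq> cball 0 1"
      using AB(1) by blast
    ultimately have Bb: "B \<subseteq> ball 0 1"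
      using cball_diff_eq_sphere[of "0::complex" 1] by blast
    define U' where "U' = U \<inter> ball 0 1"
    have U': "open U'" "U' \<subseteq> ball 0 1"
      using VU by (auto simp: U'_def)
    have BU: "B \<subseteq> U'"
      using Bb VU by (auto simp: U'_def)
    have "V \<inter> U' = {}"
      using VU by (auto simp: U'_def)
    then have "V \<inter> closure U' = {}"
      using open_Int_closure_eq_empty[OF VU(1)] by blast
    moreover have "frontier U' = closure U' - U'"
      using U'(1) by (simp add: frontier_def interior_open)
    ultimately have "frontier U' \<inter> ?F = {}"
      using AB(1) VU(4) BU by blast
    moreover have "frontier U' \<subseteq> cball 0 1"
      using closure_mono[OF U'(2)] closure_ball[of 1 "0::complex"] unfolding frontier_def by auto
    ultimately have "w ` frontier U' \<inter> K = {}"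
      by blast
    then have "w z \<notin> K" if "z \<in> U'" for z
      using avoids_chord_part[OF e p s U' _ that] by (simp add: K_def)
    then show False
      using AB BU by blast
  qed
  have "?E \<inter> A = {} \<or> ?E \<inter> B = {}"
  proof -
    have "connected ?E"
      using boundary_fibre p by simp
    moreover have "?E \<subseteq> V \<union> U"
      using EF AB VU by blast
    ultimately have "V \<inter> ?E = {} \<or> U \<inter> ?E = {}"
      using VU by (intro connectedD) auto
    then show ?thesis
      using VU by blast
  qed
  then show False
  proof
    assume "?E \<inter> A = {}"
    then show False
      using split[of B A U V] AB VU by (simp add: Un_commute Int_commute)
  next
    assume "?E \<inter> B = {}"
    then show False
      using split[of A B V U] AB VU by simp
  qed
qed

lemma connected_fibre:
  assumes q: "q \<in> cball 0 1"
  shows "connected {z \<in> cball 0 1. w z = q}"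
proof (cases "norm q = 1")
  case True
  \<comment> \<open>Over a point of the circle the chord part degenerates to its end point.\<close>
  have "chord_part 0 q 1 = {q}"
    by (simp add: chord_part_def)
  then show ?thesis
    using connected_vimage_chord_part[of 0 q 1] True by simp
next
  case False
  then have q1: "norm q < 1" using q by simp
  define S where "S p = {z \<in> cball 0 1. w z \<in> chord_part q p 0}" for p
  have S: "connected (S p)" "compact (S p)" if p: "norm p = 1" for p
  proof -
    obtain e s where es: "norm e < 1" "0 < s" "s \<le> 1" "chord_part q p 0 = chord_part e p s"
      using chord_part_0[OF q1 p] by blast
    show "connected (S p)"
      unfolding S_def es(4) by (rule connected_vimage_chord_part[OF es(1) p es(2,3)])
    show "compact (S p)"
      unfolding S_def es(4)
      by (intro compact_vimage compact_imp_closed chord_part_basic es p)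
  qed
  have Im: "chord_part q 1 0 \<inter> chord_part q (- 1) 0 = {q}"
  proof (intro equalityI subsetI)
    fix z assume "z \<in> chord_part q 1 0 \<inter> chord_part q (- 1) 0"
    then have z: "z \<in> chord_part q 1 0" "z \<in> chord_part q (- 1) 0"
      by blast+
    obtain r where r: "0 \<le> r" "z = q + of_real r * (1 - q)"
      using z(1) by (auto simp: chord_part_def)
    obtain t where t: "0 \<le> t" "z = q + of_real t * (- 1 - q)"
      using z(2) by (auto simp: chord_part_def)
    have eq: "of_real r * (1 - q) = of_real t * (- 1 - q)"
      using r(2) t(2) by simp
    have "r = 0"
      using same_ray_eq[OF q1 _ _ _ t(1) eq] r(1) by (cases "r = 0") auto
    then show "z \<in> {q}"
      using r by simp
  qed (auto simp: chord_part_def image_iff intro!: bexI[of _ 0])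
  let ?K = "S 1 \<union> S (- 1)"
  have cK: "closed ?K"
    using S[of 1] S[of "- 1"] by (simp add: closed_Un compact_imp_closed)
  \<comment> \<open>A complementary component inside the disc is excluded by pushing
    \<open>w z\<close> outwards: the rest of its ray from \<open>q\<close> misses both segments,
    which contain the image of the frontier of \<open>R\<close>.\<close>
  have bounded_comp: False if R: "R \<in> components (- ?K)" and RO: "R \<inter> - cball 0 1 = {}" for R
  proof -
    have oR: "open R"
      using R cK by (meson open_Compl open_components)
    then have Rb: "R \<subseteq> ball 0 1"
      using RO interior_maximal[of R "cball 0 1"] by auto
    have fR: "frontier R \<subseteq> ?K"
      using frontier_of_components_closed_complement cK R by blast
    obtain z where z: "z \<in> R"
      using R in_components_nonempty by blast
    have zK: "z \<notin> ?K" "z \<in> cball 0 1"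
      using z R Rb in_components_subset by (blast, auto)
    then have wz: "w z \<notin> chord_part q 1 0" "w z \<notin> chord_part q (- 1) 0" "w z \<in> cball 0 1"
      using range by (auto simp: S_def)
    moreover have "q \<in> chord_part q 1 0"
      using Im by blast
    ultimately have "w z \<noteq> q" by blast
    then obtain p t where p: "norm p = 1" and t: "1 \<le> t" "w z = q + of_real (1 / t) * (p - q)"
      using ray_to_circle[OF q1 wz(3)] by blast
    have mem: "w z \<in> chord_part q p s" if "s \<le> 1 / t" for s
      unfolding chord_part_def t(2) by (rule imageI) (use that t(1) in auto)
    \<comment> \<open>A common point would put both end points on one ray from \<open>q\<close>, so
      \<open>p = p'\<close>, and \<open>w z\<close> would lie on the segment to
      \<open>p'\<close>.\<close>
    have avoid: "chord_part q p (1/t) \<inter> chord_part q p' 0 = {}" if p': "norm p' = 1" and np: "w z \<notin> chord_part q p' 0" for p'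
    proof (rule ccontr)
      assume "chord_part q p (1/t) \<inter> chord_part q p' 0 \<noteq> {}"
      then obtain r u where ru: "1/t \<le> r" "0 \<le> u" "q + of_real r * (p - q) = q + of_real u * (p' - q)"
        unfolding chord_part_def by fastforce
      have "0 < r"
        using t(1) ru(1) by (meson divide_pos_pos less_le_trans zero_less_one)
      then have "p = p'"
        using same_ray_eq[OF q1 p p'] ru by simp
      then show False
        using np mem[of 0] t(1) by simp
    qed
    have "w ` frontier R \<subseteq> chord_part q 1 0 \<union> chord_part q (- 1) 0"
      using fR by (auto simp: S_def)
    then have "w ` frontier R \<inter> chord_part q p (1/t) = {}"
      using avoid[of 1] avoid[of "- 1"] wz by fastforce
    then have "w z \<notin> chord_part q p (1/t)"
      using t by (intro avoids_chord_part[OF q1 p _ _ oR Rb _ z]) auto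
    then show False
      using mem by blast
  qed
  have conO: "connected (- cball (0::complex) 1)"
    by (rule connected_complement_bounded_convex) auto
  moreover have OK: "- cball 0 1 \<subseteq> - ?K"
    by (auto simp: S_def)
  moreover have "- ?K \<noteq> {}"
    using S[of 1] S[of "- 1"] cobounded_imp_unbounded[of ?K] compact_imp_bounded by force
  ultimately obtain C where C: "C \<in> components (- ?K)" "- cball 0 1 \<subseteq> C"
    using exists_component_superset[OF OK] by blast
  \<comment> \<open>Any component other than \<open>C\<close> is disjoint from \<open>C\<close>,
    hence lies in the disc, contrary to \<open>bounded_comp\<close>.\<close>
  have "components (- ?K) \<subseteq> {C}"
    using bounded_comp C components_nonoverlap by blast
  then have "connected (- ?K)"
    using connected_eq_components_subset_sing_exists by blast
  then have "connected (S 1 \<inter> S (- 1))"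
    using S[of 1] S[of "- 1"] by (intro Janiszewski_dual) auto
  also have "S 1 \<inter> S (- 1) = {z \<in> cball 0 1. w z = q}"
    using Im unfolding S_def by blast
  finally show ?thesis .
qed

end

section \<open>Transport to the disc and conclusion\<close>

theorem theorem4p1:
  fixes X :: "'a::metric_space set"
    and h :: "complex \<Rightarrow> 'a" and h' :: "'a \<Rightarrow> complex"
    and v :: "complex \<Rightarrow> 'a"
  assumes geo: "geodesic_space X"
    and hom: "homeomorphism (cball 0 1) X h h'"
    and cont: "continuous_on (cball 0 1) v"
    and surj: "v ` cball 0 1 = X"
    and bdry: "weakly_monotone_param v (h ` sphere 0 1)"
    and fibres: "\<And>T C. T \<subseteq> X \<Longrightarrow> ((\<exists>p. T = {p}) \<or> bilipschitz_arc T) \<Longrightarrow>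
                   C \<in> components {z \<in> cball 0 1. v z \<in> T} \<Longrightarrow> cell_like C"
  shows "\<forall>q\<in>X. cell_like {z \<in> cball 0 1. v z = q}"
proof
  have h'h: "h' (h z) = z" if "z \<in> cball 0 1" for z
    using homeomorphism_apply1[OF hom that] .
  have hh': "h (h' x) = x" if "x \<in> X" for x
    using homeomorphism_apply2[OF hom that] .
  have h'X: "h' ` X = cball 0 1" and hD: "h ` cball 0 1 = X"
    using homeomorphism_image1[OF hom] homeomorphism_image2[OF hom] by auto
  have conth: "continuous_on (cball 0 1) h" and conth': "continuous_on X h'"
    using homeomorphism_cont1[OF hom] homeomorphism_cont2[OF hom] by auto
  have vX: "v z \<in> X" if "z \<in> cball 0 1" for z
    using surj that by blast
  interpret disc_map "h' \<circ> v"
  proof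
    show "continuous_on (cball 0 1) (h' \<circ> v)"
      using continuous_on_compose[OF cont] conth' surj by simp
    show "(h' \<circ> v) ` cball 0 1 = cball 0 1"
      using surj h'X unfolding image_comp[symmetric] by simp
    have "v ` sphere 0 1 = h ` sphere 0 1"
      using bdry by (simp add: weakly_monotone_param_def)
    moreover have "h' ` h ` sphere 0 1 = sphere 0 1"
      unfolding image_image using h'h by (simp add: image_def)
    ultimately show "(h' \<circ> v) ` sphere 0 1 = sphere 0 1"
      unfolding image_comp[symmetric] by simp
  next
    fix p :: complex assume p: "p \<in> sphere 0 1"
    \<comment> \<open>The boundary curve inherits local connectedness from the circle, which the
      fibre lemma for the parametrization requires.\<close>
    have "homeomorphism (sphere 0 1) (h ` sphere 0 1) h h'"
      using hom by (rule homeomorphism_of_subsets) (auto simp: hD[symmetric])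
    then have "sphere (0::complex) 1 homeomorphic h ` sphere 0 1"
      unfolding homeomorphic_def by blast
    moreover have "locally connected (sphere (0::complex) 1)"
      by (simp add: locally_path_connected_sphere locally_path_connected_imp_locally_connected)
    ultimately have "locally connected (h ` sphere 0 1)"
      using homeomorphic_locally[of "sphere 0 1" "h ` sphere 0 1" connected connected]
        homeomorphic_connectedness by blast
    then have "connected {z \<in> sphere 0 1. v z = h p}"
      using p by (intro weakly_monotone_param_connected_fibre[OF bdry]) auto
    moreover have "h' (v z) = p \<longleftrightarrow> v z = h p" if "z \<in> sphere 0 1" for z
    proof -
      have "z \<in> cball 0 1" "p \<in> cball 0 1"
        using that p by auto
      then show ?thesis
        using hh' h'h vX by metis
    qed
    then have "{z \<in> sphere 0 1. (h' \<circ> v) z = p} = {z \<in> sphere 0 1. v z = h p}"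
      by auto
    ultimately show "connected {z \<in> sphere 0 1. (h' \<circ> v) z = p}"
      by simp
  next
    fix S and a b :: complex
    assume S: "openin (top_of_set (cball 0 1)) S" "connected S" and ab: "a \<in> S" "b \<in> S" "a \<noteq> b"
    have SD: "S \<subseteq> cball 0 1"
      using S(1) openin_imp_subset by blast
    have hS: "openin (top_of_set X) (h ` S)"
      using homeomorphism_imp_open_map[OF hom S(1)] .
    have hSX: "h ` S \<subseteq> X"
      using SD hD by blast
    have "connected (h ` S)"
      using connected_continuous_image[OF continuous_on_subset[OF conth SD] S(2)] .
    then have "bilipschitz_joins (h ` S) (h a) (h b)"
      using bilipschitz_joins_connected[OF geo hS] ab by blast
    then obtain c d f L where cd: "c \<le> d" and L: "L > 0" and fc: "f c = h a" and fd: "f d = h b"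
      and fS: "f ` {c..d} \<subseteq> h ` S"
      and bl: "\<forall>s\<in>{c..d::real}. \<forall>t\<in>{c..d}. dist s t \<le> L * dist (f s) (f t) \<and> dist (f s) (f t) \<le> L * dist s t"
      unfolding bilipschitz_joins_def by (elim exE conjE) (rule that)
    have "c \<noteq> d"
    proof
      assume "c = d"
      then have "h a = h b" using fc fd by simp
      then have "h' (h a) = h' (h b)" by simp
      then show False
        using h'h ab SD by (metis subsetD)
    qed
    then have "c < d" using cd by simp
    let ?T = "f ` {c..d}"
    have arc: "bilipschitz_arc ?T"
      unfolding bilipschitz_arc_def using \<open>c < d\<close> L bl by blast
    have TX: "?T \<subseteq> X"
      using fS hSX by blast
    have contf: "continuous_on {c..d} f"
      by (rule lipschitz_on_continuous_on[of L]) (use bl L in \<open>auto intro!: lipschitz_onI\<close>)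
    have h'T: "h' ` ?T \<subseteq> S"
      using fS h'h SD by (auto simp: subset_iff image_subset_iff)
    \<comment> \<open>The bilipschitz arc is carried back to the disc and reparametrized over the
      unit interval.\<close>
    define g where "g = h' \<circ> f \<circ> linepath c d"
    have lp: "linepath c d ` {0..1} = {c..d}"
      using cd path_image_linepath[of c d] by (simp add: path_image_def closed_segment_eq_real_ivl)
    have img: "path_image g = h' ` ?T"
      unfolding g_def path_image_def image_comp[symmetric] lp by simp
    have "path g"
      unfolding path_def g_def
      by (intro continuous_on_compose continuous_on_linepath)
         (use lp contf continuous_on_subset[OF conth' TX] in auto)
    moreover have "pathstart g = a" "pathfinish g = b"
      using fc fd h'h ab SD by (auto simp: g_def pathstart_def pathfinish_def linepath_def)
    moreover have "connected (- C)" if C: "C \<in> components {z \<in> cball 0 1. (h' \<circ> v) z \<in> path_image g}" for C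
    proof -
      \<comment> \<open>As \<open>h'\<close> is injective on \<open>X\<close>, the preimage of the
        transported arc is that of the arc in \<open>X\<close>, to which \<open>fibres\<close>
        applies.\<close>
      have "h' (v z) \<in> h' ` ?T \<longleftrightarrow> v z \<in> ?T" if z: "z \<in> cball 0 1" for z
      proof
        assume "h' (v z) \<in> h' ` ?T"
        then obtain x where "x \<in> ?T" "h' (v z) = h' x" by blast
        then show "v z \<in> ?T"
          using hh'[of x] hh'[of "v z"] vX[OF z] TX by (metis subsetD)
      qed blast
      then have "{z \<in> cball 0 1. (h' \<circ> v) z \<in> path_image g} = {z \<in> cball 0 1. v z \<in> ?T}"
        unfolding img by auto
      then have "cell_like C"
        using fibres[OF TX] arc C by simp
      then show ?thesis
        by (rule cell_like_imp_connected_complement)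
    qed
    ultimately show "\<exists>g. path g \<and> pathstart g = a \<and> pathfinish g = b \<and> path_image g \<subseteq> S \<and>
         (\<forall>C \<in> components {z \<in> cball 0 1. (h' \<circ> v) z \<in> path_image g}. connected (- C))"
      using img h'T by (intro exI[of _ g]) simp
  qed
  fix q assume q: "q \<in> X"
  let ?F = "{z \<in> cball 0 1. v z = q}"
  have "h' (v z) = h' q \<longleftrightarrow> v z = q" if "z \<in> cball 0 1" for z
    using hh' vX[OF that] q by metis
  then have "?F = {z \<in> cball 0 1. (h' \<circ> v) z = h' q}"
    by auto
  moreover have "h' q \<in> cball 0 1"
    using h'X q by blast
  ultimately have "connected ?F"
    using connected_fibre by simp
  moreover have "?F \<noteq> {}"
    using surj q by auto
  \<comment> \<open>Being connected and nonempty, the fibre is its own component, so the hypothesis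
    on single points gives cell-likeness.\<close>
  ultimately have "?F \<in> components {z \<in> cball 0 1. v z \<in> {q}}"
    using components_eq_sing_iff[of ?F] by simp
  then show "cell_like ?F"
    using fibres[of "{q}"] q by blast
qed

end
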